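(* Let $n\ge 1$ and let $\mathcal{I}$ be an interval hypergraph on $[n]$ containing all singletons. Then $P_{\mathcal{I}}$ is a distributive lattice if and only if for all $I,J\in\mathcal{I}$ such that $I\not\subseteq J$, $I\not\supseteq J$ and $I\cap J\neq\varnothing$, the intersection $I\cap J$ belongs to $\mathcal{I}$ and is an initial or a final subinterval of every $K\in\mathcal{I}$ with $I\cap J\subseteq K$ (i.e. $\min(I\cap J)=\min K$ or $\max(I\cap J)=\max K$).
   Context: A hypergraph $\mathcal{H}$ on $[n]=\{1,\dots,n\}$ is a collection of subsets of $[n]$; by convention it contains all singletons. An interval hypergraph is a hypergraph all of whose members are intervals $[i,j]=\{i,\dots,j\}$. An orientation of $\mathcal{H}$ is a map $O:\mathcal{H}\to[n]$ with $O(H)\in H$ for all $H$. It is acyclic if there are no $H_1,\dots,H_k\in\mathcal{H}$, $k\ge2$, with $O(H_{i+1})\in H_i\setminus\{O(H_i)\}$ for $i\in[k-1]$ and $O(H_1)\in H_k\setminus\{O(H_k)\}$. Two orientations $O\neq O'$ are related by an increasing flip (from $O$ to $O'$) if there exist $1\le i<j\le n$ such that for all $H\in\mathcal{H}$: if $O(H)\ne O'(H)$ then $O(H)=i$ and $O'(H)=j$; and if $\{i,j\}\subseteq H$ then $O(H)=i\iff O'(H)=j$. The hypergraphic poset $P_{\mathcal{H}}$ is the transitive closure of the increasing flip relation on the set of acyclic orientations of $\mathcal{H}$. *)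

theory Defs
  imports Main "HOL-Library.FuncSet" "HOL-Algebra.Lattice"
begin

(* A hypergraph on [n] containing all singletons *)
definition hypergraph :: "nat \<Rightarrow> nat set set \<Rightarrow> bool" where
  "hypergraph n \<H> \<longleftrightarrow> (\<forall>H\<in>\<H>. H \<subseteq> {1..n}) \<and> (\<forall>i\<in>{1..n}. {i} \<in> \<H>)"

(* all members are (nonempty) intervals [i,j] of [n] *)
definition interval_hypergraph :: "nat \<Rightarrow> nat set set \<Rightarrow> bool" where
  "interval_hypergraph n \<H> \<longleftrightarrow> hypergraph n \<H> \<and>
     (\<forall>H\<in>\<H>. \<exists>i j. 1 \<le> i \<and> i \<le> j \<and> j \<le> n \<and> H = {i..j})"

(* orientations: maps Or with Or H \<in> H, extensional outside \<H> *)
definition orientations :: "nat set set \<Rightarrow> (nat set \<Rightarrow> nat) set" where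
  "orientations \<H> = (\<Pi>\<^sub>E H\<in>\<H>. H)"

definition acyclic_orientation :: "nat set set \<Rightarrow> (nat set \<Rightarrow> nat) \<Rightarrow> bool" where
  "acyclic_orientation \<H> Or \<longleftrightarrow> Or \<in> orientations \<H> \<and>
     \<not> (\<exists>k::nat. k \<ge> 2 \<and> (\<exists>Hs::nat \<Rightarrow> nat set.
          (\<forall>i<k. Hs i \<in> \<H>) \<and>
          (\<forall>i<k. Or (Hs ((i + 1) mod k)) \<in> Hs i - {Or (Hs i)})))"

definition increasing_flip :: "nat \<Rightarrow> nat set set \<Rightarrow> (nat set \<Rightarrow> nat) \<Rightarrow> (nat set \<Rightarrow> nat) \<Rightarrow> bool" where
  "increasing_flip n \<H> Or Or' \<longleftrightarrow> Or \<noteq> Or' \<and>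
     (\<exists>i j. 1 \<le> i \<and> i < j \<and> j \<le> n \<and>
        (\<forall>H\<in>\<H>. (Or H \<noteq> Or' H \<longrightarrow> Or H = i \<and> Or' H = j) \<and>
                 ({i, j} \<subseteq> H \<longrightarrow> (Or H = i \<longleftrightarrow> Or' H = j))))"

definition acyclic_orientations :: "nat set set \<Rightarrow> (nat set \<Rightarrow> nat) set" where
  "acyclic_orientations \<H> = {Or. acyclic_orientation \<H> Or}"

(* the hypergraphic poset P_H: reflexive-transitive closure of increasing flips
   between acyclic orientations *)
definition hypergraphic_poset :: "nat \<Rightarrow> nat set set \<Rightarrow> (nat set \<Rightarrow> nat) gorder" where
  "hypergraphic_poset n \<H> = \<lparr> carrier = acyclic_orientations \<H>, eq = (=),
     le = (\<lambda>Or Or'. (Or, Or') \<in> {(P, Q). P \<in> acyclic_orientations \<H> \<and> Q \<in> acyclic_orientations \<H>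
                                       \<and> increasing_flip n \<H> P Q}\<^sup>*) \<rparr>"

definition distributive_lattice :: "('a, 'b) gorder_scheme \<Rightarrow> bool" where
  "distributive_lattice L \<longleftrightarrow> lattice L \<and>
     (\<forall>x\<in>carrier L. \<forall>y\<in>carrier L. \<forall>z\<in>carrier L.
        x \<sqinter>\<^bsub>L\<^esub> (y \<squnion>\<^bsub>L\<^esub> z) = (x \<sqinter>\<^bsub>L\<^esub> y) \<squnion>\<^bsub>L\<^esub> (x \<sqinter>\<^bsub>L\<^esub> z))"

end

theory Submission
  imports Defs
begin

text \<open>For intervals, an orientation is acyclic iff it has no 2-cycle, and the hypergraphic poset is
  the pointwise order on acyclic orientations.

  If the condition holds, no two crossing members lie in a common member, so the maximal proper
  subintervals of each non-singleton \<open>K\<close> partition \<open>K\<close> into consecutive blocks. An acyclic orientation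
  is determined by the block of each \<open>K\<close> in which its value lies, these blocks can be prescribed
  freely, and the order is coordinatewise: the poset is a product of chains.

  Conversely, let \<open>I = [a,b]\<close> and \<open>J = [c,d]\<close> cross, with \<open>a < c \<le> b < d\<close>. If \<open>[c,b]\<close> is missing, there are
  four acyclic orientations \<open>A1, A2 \<le> B1, B2\<close> such that any \<open>M\<close> in between would satisfy
  \<open>M I = c\<close> and \<open>M J = b\<close>, a 2-cycle. If \<open>[c,b]\<close> is interior to a member \<open>K\<close>, closure under
  intersection lets us shrink \<open>I\<close> and \<open>J\<close> into \<open>K\<close>, where a pentagon violates distributivity.\<close>

section \<open>Criteria for and against distributivity\<close>

text \<open>Since coordinatewise maxima and minima are realized, they are the joins and meets;
  distributivity is then that of \<open>min\<close> over \<open>max\<close> in a chain.\<close>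

lemma distributive_latticeI_coordinates:
  fixes L :: "('a, 'b) gorder_scheme" and f :: "'a \<Rightarrow> 'k \<Rightarrow> 'c::linorder"
  assumes eq: "\<And>x y. x .=\<^bsub>L\<^esub> y \<longleftrightarrow> x = y"
    and le: "\<And>x y. x \<in> carrier L \<Longrightarrow> y \<in> carrier L \<Longrightarrow> x \<sqsubseteq>\<^bsub>L\<^esub> y \<longleftrightarrow> (\<forall>k\<in>S. f x k \<le> f y k)"
    and inj: "\<And>x y. x \<in> carrier L \<Longrightarrow> y \<in> carrier L \<Longrightarrow> \<forall>k\<in>S. f x k = f y k \<Longrightarrow> x = y"
    and max: "\<And>x y. x \<in> carrier L \<Longrightarrow> y \<in> carrier L \<Longrightarrow> \<exists>z\<in>carrier L. \<forall>k\<in>S. f z k = max (f x k) (f y k)"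
    and min: "\<And>x y. x \<in> carrier L \<Longrightarrow> y \<in> carrier L \<Longrightarrow> \<exists>z\<in>carrier L. \<forall>k\<in>S. f z k = min (f x k) (f y k)"
  shows "distributive_lattice L"
proof -
  interpret partial_order L
  proof
    fix x y z w
    show "x .=\<^bsub>L\<^esub> x" by (simp add: eq)
    show "y .=\<^bsub>L\<^esub> x" if "x .=\<^bsub>L\<^esub> y" using that by (simp add: eq)
    show "x .=\<^bsub>L\<^esub> z" if "x .=\<^bsub>L\<^esub> y" "y .=\<^bsub>L\<^esub> z" using that by (simp add: eq)
    show "(.=\<^bsub>L\<^esub>) = (=)" by (intro ext) (rule eq)
    show "x \<sqsubseteq>\<^bsub>L\<^esub> z \<longleftrightarrow> y \<sqsubseteq>\<^bsub>L\<^esub> w" if "x .=\<^bsub>L\<^esub> y" "z .=\<^bsub>L\<^esub> w" using that by (simp add: eq)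
    show "x .=\<^bsub>L\<^esub> y" if "x \<sqsubseteq>\<^bsub>L\<^esub> y" "y \<sqsubseteq>\<^bsub>L\<^esub> x" "x \<in> carrier L" "y \<in> carrier L"
      using that le inj[of x y] by (auto simp: eq intro: antisym)
    show "x \<sqsubseteq>\<^bsub>L\<^esub> z" if "x \<sqsubseteq>\<^bsub>L\<^esub> y" "y \<sqsubseteq>\<^bsub>L\<^esub> z" "x \<in> carrier L" "y \<in> carrier L" "z \<in> carrier L"
      using that le by (meson order_trans)
    show "x \<sqsubseteq>\<^bsub>L\<^esub> x" if "x \<in> carrier L" using that le by simp
  qed
  interpret lattice L
  proof
    fix x y assume xy: "x \<in> carrier L" "y \<in> carrier L"
    obtain z where z: "z \<in> carrier L" "\<forall>k\<in>S. f z k = max (f x k) (f y k)" using max[OF xy] by blast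
    then have "least L z (Upper L {x, y})"
      using xy by (intro least_UpperI) (auto simp: le Upper_def)
    then show "\<exists>s. least L s (Upper L {x, y})" ..
    obtain z where z: "z \<in> carrier L" "\<forall>k\<in>S. f z k = min (f x k) (f y k)" using min[OF xy] by blast
    then have "greatest L z (Lower L {x, y})"
      using xy by (intro greatest_LowerI) (auto simp: le Lower_def)
    then show "\<exists>s. greatest L s (Lower L {x, y})" ..
  qed
  have join: "f (x \<squnion>\<^bsub>L\<^esub> y) k = Orderings.max (f x k) (f y k)"
    if xy: "x \<in> carrier L" "y \<in> carrier L" and k: "k \<in> S" for x y k
  proof -
    obtain z where z: "z \<in> carrier L" "\<forall>k\<in>S. f z k = Orderings.max (f x k) (f y k)" using max[OF xy] by blast
    then have "x \<squnion>\<^bsub>L\<^esub> y \<sqsubseteq>\<^bsub>L\<^esub> z" using xy by (intro join_le) (auto simp: le)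
    then have "f (x \<squnion>\<^bsub>L\<^esub> y) k \<le> f z k" using le z(1) xy k by simp
    moreover have "f x k \<le> f (x \<squnion>\<^bsub>L\<^esub> y) k" using join_left[OF xy] le xy k by simp
    moreover have "f y k \<le> f (x \<squnion>\<^bsub>L\<^esub> y) k" using join_right[OF xy] le xy k by simp
    ultimately show ?thesis using z(2) k by (auto intro: antisym)
  qed
  have meet: "f (x \<sqinter>\<^bsub>L\<^esub> y) k = Orderings.min (f x k) (f y k)"
    if xy: "x \<in> carrier L" "y \<in> carrier L" and k: "k \<in> S" for x y k
  proof -
    obtain z where z: "z \<in> carrier L" "\<forall>k\<in>S. f z k = Orderings.min (f x k) (f y k)" using min[OF xy] by blast
    then have "z \<sqsubseteq>\<^bsub>L\<^esub> x \<sqinter>\<^bsub>L\<^esub> y" using xy by (intro meet_le) (auto simp: le)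
    then have "f z k \<le> f (x \<sqinter>\<^bsub>L\<^esub> y) k" using le z(1) xy k by simp
    moreover have "f (x \<sqinter>\<^bsub>L\<^esub> y) k \<le> f x k" using meet_left[OF xy] le xy k by simp
    moreover have "f (x \<sqinter>\<^bsub>L\<^esub> y) k \<le> f y k" using meet_right[OF xy] le xy k by simp
    ultimately show ?thesis using z(2) k by (auto intro: antisym)
  qed
  show ?thesis
    unfolding distributive_lattice_def
  proof (intro conjI ballI lattice_axioms)
    fix x y z assume "x \<in> carrier L" "y \<in> carrier L" "z \<in> carrier L"
    then show "x \<sqinter>\<^bsub>L\<^esub> (y \<squnion>\<^bsub>L\<^esub> z) = (x \<sqinter>\<^bsub>L\<^esub> y) \<squnion>\<^bsub>L\<^esub> (x \<sqinter>\<^bsub>L\<^esub> z)"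
      by (intro inj) (simp_all add: join meet min_max_distrib2)
  qed
qed

text \<open>Excludes a pentagon without computing joins or meets: \<open>Z\<close> is below the join
  of \<open>X\<close> and \<open>Y\<close>, the meet of \<open>Z\<close> and \<open>Y\<close> is
  below \<open>X\<close>, and expanding the meet of \<open>Z\<close> with that join puts
  \<open>Z\<close> below \<open>X\<close>.\<close>

lemma distributive_lattice_modular_cancel:
  assumes "distributive_lattice L"
    and X: "X \<in> carrier L" and Y: "Y \<in> carrier L" and Z: "Z \<in> carrier L"
    and upper: "\<And>U. U \<in> carrier L \<Longrightarrow> X \<sqsubseteq>\<^bsub>L\<^esub> U \<Longrightarrow> Y \<sqsubseteq>\<^bsub>L\<^esub> U \<Longrightarrow> Z \<sqsubseteq>\<^bsub>L\<^esub> U"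
    and lower: "\<And>V. V \<in> carrier L \<Longrightarrow> V \<sqsubseteq>\<^bsub>L\<^esub> Z \<Longrightarrow> V \<sqsubseteq>\<^bsub>L\<^esub> Y \<Longrightarrow> V \<sqsubseteq>\<^bsub>L\<^esub> X"
  shows "Z \<sqsubseteq>\<^bsub>L\<^esub> X"
proof -
  interpret lattice L using assms(1) by (simp add: distributive_lattice_def)
  have "Z \<sqsubseteq>\<^bsub>L\<^esub> X \<squnion>\<^bsub>L\<^esub> Y" using X Y by (intro upper join_left join_right) auto
  then have "Z \<sqsubseteq>\<^bsub>L\<^esub> Z \<sqinter>\<^bsub>L\<^esub> (X \<squnion>\<^bsub>L\<^esub> Y)" using X Y Z by (intro meet_le) auto
  also have "Z \<sqinter>\<^bsub>L\<^esub> (X \<squnion>\<^bsub>L\<^esub> Y) = (Z \<sqinter>\<^bsub>L\<^esub> X) \<squnion>\<^bsub>L\<^esub> (Z \<sqinter>\<^bsub>L\<^esub> Y)"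
    using assms(1) X Y Z by (simp add: distributive_lattice_def)
  also have "\<dots> \<sqsubseteq>\<^bsub>L\<^esub> X"
    using X Y Z by (intro join_le meet_right lower meet_left) auto
  finally show ?thesis using X Y Z by simp
qed

section \<open>Acyclicity of orientations of interval hypergraphs\<close>

lemma Min_nat_interval [simp]: "a \<le> b \<Longrightarrow> Min {a..b::nat} = a"
  and Max_nat_interval [simp]: "a \<le> b \<Longrightarrow> Max {a..b::nat} = b"
  by (auto intro: Min_eqI Max_eqI)

locale interval_hg =
  fixes n :: nat and \<I> :: "nat set set"
  assumes interval_hypergraph: "interval_hypergraph n \<I>"
begin

lemma hyperedgeE:
  assumes "H \<in> \<I>"
  obtains i j where "1 \<le> i" "i \<le> j" "j \<le> n" "H = {i..j}"
  using assms interval_hypergraph unfolding interval_hypergraph_def by blast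

lemma hyperedge_nonempty: "H \<in> \<I> \<Longrightarrow> H \<noteq> {}"
  by (auto elim!: hyperedgeE)

lemma hyperedge_finite: "H \<in> \<I> \<Longrightarrow> finite H"
  by (auto elim!: hyperedgeE)

lemma hyperedge_range: "H \<in> \<I> \<Longrightarrow> x \<in> H \<Longrightarrow> 1 \<le> x \<and> x \<le> n"
  by (auto elim!: hyperedgeE)

lemma hyperedge_convex: "H \<in> \<I> \<Longrightarrow> x \<in> H \<Longrightarrow> z \<in> H \<Longrightarrow> x \<le> y \<Longrightarrow> y \<le> z \<Longrightarrow> y \<in> H"
  by (auto elim!: hyperedgeE)

lemma singleton_hyperedge: "H \<in> \<I> \<Longrightarrow> x \<in> H \<Longrightarrow> {x} \<in> \<I>"
  using interval_hypergraph hyperedge_range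
  unfolding interval_hypergraph_def hypergraph_def by simp

lemma finite_hyperedges: "finite \<I>"
  by (rule finite_subset[of _ "Pow {1..n}"]) (auto elim!: hyperedgeE)

text \<open>The case k = 2 of acyclicity. Values outside \<open>\<I>\<close> are left free, so that
  plain functions such as \<open>Min\<close> qualify.\<close>

definition compat :: "(nat set \<Rightarrow> nat) \<Rightarrow> bool" where
  "compat A \<longleftrightarrow> (\<forall>H\<in>\<I>. A H \<in> H) \<and> (\<forall>H\<in>\<I>. \<forall>K\<in>\<I>. A H \<in> K \<longrightarrow> A K \<in> H \<longrightarrow> A H = A K)"

lemma compat_mem: "compat A \<Longrightarrow> H \<in> \<I> \<Longrightarrow> A H \<in> H"
  by (simp add: compat_def)

lemma compat_eq: "compat A \<Longrightarrow> H \<in> \<I> \<Longrightarrow> K \<in> \<I> \<Longrightarrow> A H \<in> K \<Longrightarrow> A K \<in> H \<Longrightarrow> A H = A K"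
  by (simp add: compat_def)

text \<open>A cycle is shortened by deleting its smallest vertex: by convexity, either the predecessor
  of that vertex sees its successor, or the vertex and its predecessor form a 2-cycle.\<close>

lemma compat_no_cycle:
  assumes A: "compat A"
    and "\<And>j. F j \<in> \<I>" "\<And>j. A (F (Suc j)) \<in> F j" "\<And>j. A (F (Suc j)) \<noteq> A (F j)"
    and "\<And>j. F (j + k) = F j" "k \<ge> 1"
  shows False
  using assms(2-)
proof (induction k arbitrary: F)
  case 0
  then show ?case by simp
next
  case (Suc k)
  note per = Suc.prems(4)
  show ?case
  proof (cases "k = 0")
    case True
    then have "F (Suc 0) = F 0" using per[of 0] by simp
    then show False using Suc.prems(3)[of 0] by simp
  next
    case False
    obtain m where m: "\<And>j. A (F m) \<le> A (F j)"
      using ex_has_least_nat[of "\<lambda>_. True" _ "\<lambda>j. A (F j)"] by blast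
    \<comment> \<open>\<open>G\<close> follows the cycle of length \<open>Suc k\<close> from the
      successor of \<open>m\<close> on, leaves out \<open>F m\<close> and closes up with period
      \<open>k\<close>.\<close>
    define G where "G j = F (Suc m + j mod k)" for j
    have next_m: "F (Suc (m + k)) = F m" using per[of m] by simp
    have shortcut: "A (F (Suc m)) \<in> F (m + k) \<and> A (F (Suc m)) \<noteq> A (F (m + k))"
    proof -
      have 1: "A (F m) \<in> F (m + k)" "A (F m) \<noteq> A (F (m + k))"
        using Suc.prems(2,3)[of "m + k"] next_m by auto
      \<comment> \<open>Without 2-cycles the predecessor's value is outside \<open>F m\<close>, so
        by convexity and minimality it exceeds the value at \<open>Suc m\<close>. The latter thus
        lies between two elements of \<open>F (m + k)\<close>.\<close>
      have "A (F (m + k)) \<notin> F m"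
        using compat_eq[OF A Suc.prems(1) Suc.prems(1)] 1 by metis
      then have "A (F (Suc m)) < A (F (m + k))"
        using hyperedge_convex[OF Suc.prems(1)[of m] compat_mem[OF A Suc.prems(1)] Suc.prems(2)] m
        by (meson not_less)
      then show ?thesis
        using hyperedge_convex[OF Suc.prems(1)[of "m + k"] 1(1) compat_mem[OF A Suc.prems(1)], of "A (F (Suc m))"] m[of "Suc m"]
        by simp
    qed
    have step: "A (G (Suc j)) \<in> G j \<and> A (G (Suc j)) \<noteq> A (G j)" for j
    proof (cases "Suc (j mod k) = k")
      case True
      then have 1: "m + k = Suc m + j mod k" and 2: "Suc j mod k = 0" by (auto simp: mod_Suc)
      have "G j = F (m + k)" unfolding G_def 1 by (rule refl)
      moreover have "G (Suc j) = F (Suc m)" unfolding G_def 2 by simp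
      ultimately show ?thesis using shortcut by simp
    next
      case False
      then have "G (Suc j) = F (Suc (Suc m + j mod k))"
        unfolding G_def by (simp add: mod_Suc)
      then show ?thesis using Suc.prems(2,3) unfolding G_def by simp
    qed
    show False
    proof (rule Suc.IH[of G])
      show "G j \<in> \<I>" for j unfolding G_def by (rule Suc.prems(1))
      show "G (j + k) = G j" for j unfolding G_def by simp
    qed (use step False in auto)
  qed
qed

lemma acyclic_orientations_iff:
  "A \<in> acyclic_orientations \<I> \<longleftrightarrow> A \<in> extensional \<I> \<and> compat A"
proof
  assume "A \<in> acyclic_orientations \<I>"
  then have or: "A \<in> orientations \<I>" and
    ac: "\<And>(k::nat) Hs. 2 \<le> k \<Longrightarrow> \<forall>i<k. Hs i \<in> \<I> \<Longrightarrow>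
       \<forall>i<k. A (Hs ((i + 1) mod k)) \<in> Hs i - {A (Hs i)} \<Longrightarrow> False"
    unfolding acyclic_orientations_def acyclic_orientation_def by blast+
  have "A H = A K" if "H \<in> \<I>" "K \<in> \<I>" "A H \<in> K" "A K \<in> H" for H K
  proof (rule ccontr)
    assume "A H \<noteq> A K"
    then show False
      using that by (intro ac[of 2 "\<lambda>i. if i = 0 then H else K"]) (auto simp: less_2_cases_iff)
  qed
  then show "A \<in> extensional \<I> \<and> compat A"
    using or unfolding orientations_def compat_def PiE_def by auto
next
  assume A: "A \<in> extensional \<I> \<and> compat A"
  have False if k: "2 \<le> k" and Hs: "\<forall>i<k. Hs i \<in> \<I>"
    "\<forall>i<k. A (Hs ((i + 1) mod k)) \<in> Hs i - {A (Hs i)}" for k :: nat and Hs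
  proof (rule compat_no_cycle[of A "\<lambda>j. Hs (j mod k)" k])
    fix j
    have lt: "j mod k < k" using k by simp
    have "(j mod k + 1) mod k = Suc j mod k" by (simp add: mod_simps)
    then show "A (Hs (Suc j mod k)) \<in> Hs (j mod k)" "A (Hs (Suc j mod k)) \<noteq> A (Hs (j mod k))"
      using Hs(2)[rule_format, OF lt] by auto
  qed (use A k Hs in auto)
  moreover have "A \<in> orientations \<I>"
    using A compat_mem unfolding orientations_def by (auto simp: PiE_def)
  ultimately show "A \<in> acyclic_orientations \<I>"
    unfolding acyclic_orientations_def acyclic_orientation_def by blast
qed

lemma restrict_acyclic: "compat A \<Longrightarrow> restrict A \<I> \<in> acyclic_orientations \<I>"
  unfolding acyclic_orientations_iff by (auto simp: compat_def)

section \<open>Increasing flips and the pointwise order\<close>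

text \<open>The flip moves \<open>i\<close> to \<open>j\<close>, where \<open>i\<close> is the largest value of \<open>A\<close> at which \<open>B\<close> differs, and \<open>j\<close> is
  the largest target that keeps the result below \<open>B\<close>; maximality of both makes it acyclic.\<close>

lemma exists_flip:
  assumes A: "compat A" and B: "compat B" and le: "\<And>H. H \<in> \<I> \<Longrightarrow> A H \<le> B H"
    and ne: "\<exists>H\<in>\<I>. A H \<noteq> B H" and ext: "A \<in> extensional \<I>"
  shows "\<exists>C. C \<in> acyclic_orientations \<I> \<and> increasing_flip n \<I> A C \<and> (\<forall>H\<in>\<I>. A H \<le> C H \<and> C H \<le> B H)"
proof -
  define D where "D = {A H |H. H \<in> \<I> \<and> A H < B H}"
  have "finite D" "D \<noteq> {}"
    using finite_hyperedges ne le unfolding D_def by (auto simp: le_less)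
  define i where "i = Max D"
  have "i \<in> D" unfolding i_def by (rule Max_in) fact+
  then obtain H0 where H0: "H0 \<in> \<I>" "A H0 = i" "i < B H0" unfolding D_def by auto
  have above: "B K = A K" if "K \<in> \<I>" "i < A K" for K
  proof (rule ccontr)
    assume "B K \<noteq> A K"
    then have "A K \<in> D" using that le[of K] unfolding D_def by (auto intro!: exI[of _ K])
    then show False using Max_ge[OF \<open>finite D\<close>] that unfolding i_def by (meson not_less)
  qed
  define S where "S = {j. i < j \<and> (\<exists>H\<in>\<I>. A H = i \<and> j \<in> H) \<and> (\<forall>H\<in>\<I>. A H = i \<and> j \<in> H \<longrightarrow> j \<le> B H)}"
  have "finite S"
    by (rule finite_subset[of _ "{..n}"]) (use hyperedge_range in \<open>auto simp: S_def\<close>)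
  have "S \<noteq> {}"
  proof -
    \<comment> \<open>The least \<open>B\<close>-value reached from \<open>i\<close> is an
      admissible target: a hyperedge containing it whose value stayed at \<open>i\<close> would form
      a 2-cycle of \<open>B\<close> with \<open>H1\<close>.\<close>
    obtain H1 where H1: "H1 \<in> \<I>" "A H1 = i" "i < B H1"
      and least: "\<And>H. H \<in> \<I> \<Longrightarrow> A H = i \<Longrightarrow> i < B H \<Longrightarrow> B H1 \<le> B H"
      using ex_has_least_nat[of "\<lambda>H. H \<in> \<I> \<and> A H = i \<and> i < B H" H0 B] H0 by blast
    have "B H1 \<le> B H" if H: "H \<in> \<I>" "A H = i" "B H1 \<in> H" for H
    proof (rule least[OF H(1,2)])
      have "B H \<noteq> i"
      proof
        assume "B H = i"
        then have "B H \<in> H1" using compat_mem[OF A H1(1)] H1(2) by simp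
        then show False using compat_eq[OF B H(1) H1(1)] H(3) H1(3) \<open>B H = i\<close> by simp
      qed
      then show "i < B H" using le[OF H(1)] H(2) by simp
    qed
    then have "B H1 \<in> S" using H1 compat_mem[OF B H1(1)] unfolding S_def by auto
    then show ?thesis by auto
  qed
  define j where "j = Max S"
  have "j \<in> S" unfolding j_def by (rule Max_in) fact+
  then obtain H1 where ij: "i < j" and H1: "H1 \<in> \<I>" "A H1 = i" "j \<in> H1"
    and jle: "\<And>H. H \<in> \<I> \<Longrightarrow> A H = i \<Longrightarrow> j \<in> H \<Longrightarrow> j \<le> B H"
    unfolding S_def by auto
  have jmax: "k \<le> j" if "k \<in> S" for k
    unfolding j_def by (rule Max_ge) fact+
  \<comment> \<open>The only mixed case for acyclicity after the flip: \<open>H\<close> is flipped,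
    \<open>K\<close> is not, and each contains the new value of the other.\<close>
  have key: "A K = j"
    if H: "H \<in> \<I>" "A H = i" "j \<in> H" and K: "K \<in> \<I>" "A K \<noteq> i" "A K \<in> H" "j \<in> K" for H K
  proof (rule ccontr)
    assume kj: "A K \<noteq> j"
    have iH: "A H' = i \<Longrightarrow> H' \<in> \<I> \<Longrightarrow> i \<in> H'" for H' using compat_mem[OF A] by metis
    have iK: "i \<notin> K" using compat_eq[OF A H(1) K(1)] H(2) K(2,3) by auto
    have ik: "i < A K"
    proof (rule ccontr)
      assume "\<not> i < A K"
      then have "i \<in> K" using hyperedge_convex[OF K(1) compat_mem[OF A K(1)] K(4)] ij by simp
      then show False using iK by simp
    qed
    have BK: "B K = A K" using above[OF K(1) ik] .
    have BH': "B H' = A K" if "H' \<in> \<I>" "A K \<in> H'" "B H' \<in> K" for H'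
      using compat_eq[OF B that(1) K(1)] that BK by simp
    show False
    proof (cases "j < A K")
      case True
      \<comment> \<open>A \<open>B\<close>-value between \<open>j\<close> and \<open>A K\<close>
        would lie in \<open>K\<close>, hence equal \<open>A K\<close>; so \<open>A K\<close> is a
        larger admissible target than \<open>j\<close>.\<close>
      have "A K \<in> S"
        unfolding S_def
      proof (intro CollectI conjI ballI impI; (elim conjE)?)
        show "\<exists>H\<in>\<I>. A H = i \<and> A K \<in> H" using H K by auto
        fix H' assume H': "H' \<in> \<I>" "A H' = i" "A K \<in> H'"
        have "j \<in> H'" using hyperedge_convex[OF H'(1) iH[OF H'(2,1)] H'(3)] ij True by simp
        then have "j \<le> B H'" using jle H' by blast
        then show "A K \<le> B H'"
          using hyperedge_convex[OF K(1,4) compat_mem[OF A K(1)], of "B H'"] BH'[OF H'(1,3)]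
          by (cases "A K \<le> B H'") auto
      qed (fact ik)
      then show False using jmax True by fastforce
    next
      case False
      then have kj: "A K < j" using kj by simp
      \<comment> \<open>Here \<open>i < A K < j\<close>. A \<open>B\<close>-value of at least
        \<open>j\<close> inside \<open>K\<close> would have to equal \<open>A K\<close>, so
        \<open>B\<close> jumps past the right end \<open>v\<close>, and \<open>Suc v\<close> is an
        admissible target beyond \<open>j\<close>.\<close>
      obtain u v where uv: "K = {u..v}" using hyperedgeE[OF K(1)] by metis
      have Bv: "v < B H'" if H': "H' \<in> \<I>" "A H' = i" "j \<in> H'" for H'
      proof -
        have k: "A K \<in> H'" using hyperedge_convex[OF H'(1) iH[OF H'(2,1)] H'(3)] ik kj by simp
        show ?thesis using BH'[OF H'(1) k] jle[OF H'] kj K(4) uv by (cases "B H' \<le> v") auto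
      qed
      have jv: "j \<le> v" using K(4) uv by simp
      have "Suc v \<in> S"
        unfolding S_def
      proof (intro CollectI conjI ballI impI; (elim conjE)?)
        have "Suc v \<in> H"
          using hyperedge_convex[OF H(1,3) compat_mem[OF B H(1)], of "Suc v"] Bv[OF H] jv by simp
        then show "\<exists>H\<in>\<I>. A H = i \<and> Suc v \<in> H" using H by auto
        show "i < Suc v" using ij jv by simp
        fix H' assume H': "H' \<in> \<I>" "A H' = i" "Suc v \<in> H'"
        have "j \<in> H'" using hyperedge_convex[OF H'(1) iH[OF H'(2,1)] H'(3)] ij jv by simp
        then show "Suc v \<le> B H'" using Bv H' by (simp add: Suc_le_eq)
      qed
      then show False using jmax jv by fastforce
    qed
  qed
  define C where "C H = (if A H = i \<and> j \<in> H then j else A H)" for H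
  have C: "compat C"
    unfolding compat_def
  proof (intro conjI ballI impI)
    show "C H \<in> H" if "H \<in> \<I>" for H using that compat_mem[OF A] unfolding C_def by auto
    fix H K assume "H \<in> \<I>" "K \<in> \<I>" "C H \<in> K" "C K \<in> H"
    then show "C H = C K"
      using key[of H K] key[of K H] compat_eq[OF A, of H K] unfolding C_def by (auto split: if_splits)
  qed
  have "A H1 \<noteq> restrict C \<I> H1" using H1 ij unfolding C_def by simp
  then have "A \<noteq> restrict C \<I>" by auto
  moreover have "1 \<le> i" using hyperedge_range[OF H0(1)] compat_mem[OF A H0(1)] H0(2) by simp
  moreover have "j \<le> n" using hyperedge_range H1 by simp
  moreover have "A H = i \<and> restrict C \<I> H = j" if "H \<in> \<I>" "A H \<noteq> restrict C \<I> H" for H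
    using that unfolding C_def by (auto split: if_splits)
  moreover have "A H = i \<longleftrightarrow> restrict C \<I> H = j" if "H \<in> \<I>" "{i, j} \<subseteq> H" for H
  proof -
    have "A H \<noteq> j" using compat_eq[OF A that(1) H1(1)] H1 ij that by auto
    then show ?thesis using that unfolding C_def by auto
  qed
  ultimately have "increasing_flip n \<I> A (restrict C \<I>)"
    unfolding increasing_flip_def using ij by blast
  moreover have "A H \<le> C H \<and> C H \<le> B H" if "H \<in> \<I>" for H
    using le[OF that] jle that ij unfolding C_def by auto
  ultimately show ?thesis
    using restrict_acyclic[OF C] by (intro exI[of _ "restrict C \<I>"]) auto
qed

abbreviation P where "P \<equiv> hypergraphic_poset n \<I>"

lemma carrier_P: "A \<in> carrier P \<longleftrightarrow> A \<in> extensional \<I> \<and> compat A"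
  by (simp add: hypergraphic_poset_def acyclic_orientations_iff)

text \<open>Flips only raise values. Conversely, while \<open>A\<close> and \<open>B\<close> differ,
  \<open>exists_flip\<close> raises \<open>A\<close> without passing \<open>B\<close>, and the total
  distance to \<open>B\<close> drops.\<close>

lemma le_P_iff:
  assumes "A \<in> carrier P" "B \<in> carrier P"
  shows "A \<sqsubseteq>\<^bsub>P\<^esub> B \<longleftrightarrow> (\<forall>H\<in>\<I>. A H \<le> B H)"
proof -
  define R where "R = {(X, Y). X \<in> acyclic_orientations \<I> \<and> Y \<in> acyclic_orientations \<I> \<and> increasing_flip n \<I> X Y}"
  have "\<forall>H\<in>\<I>. A H \<le> B H" if "(A, B) \<in> R\<^sup>*"
    using that
  proof (induction rule: rtrancl_induct)
    case base
    show ?case by simp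
  next
    case (step Y Z)
    show ?case
    proof (intro ballI)
      fix H assume H: "H \<in> \<I>"
      have "increasing_flip n \<I> Y Z" using step(2) by (simp add: R_def)
      then have "Y H \<le> Z H" using H unfolding increasing_flip_def by (metis less_imp_le order_refl)
      then show "A H \<le> Z H" using step(3) H by (meson le_trans)
    qed
  qed
  moreover have "(A, B) \<in> R\<^sup>*" if "\<forall>H\<in>\<I>. A H \<le> B H"
    using assms(1) that
  proof (induction "\<Sum>H\<in>\<I>. B H - A H" arbitrary: A rule: less_induct)
    case less
    show ?case
    proof (cases "A = B")
      case False
      then have "\<exists>H\<in>\<I>. A H \<noteq> B H"
        using less.prems(1) assms(2) unfolding carrier_P by (meson extensionalityI)
      then obtain C where C: "C \<in> acyclic_orientations \<I>" "increasing_flip n \<I> A C"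
        "\<forall>H\<in>\<I>. A H \<le> C H \<and> C H \<le> B H"
        using exists_flip[of A B] less.prems assms(2) unfolding carrier_P by blast
      have CP: "C \<in> carrier P" using C(1) by (simp add: hypergraphic_poset_def)
      have "A \<noteq> C" using C(2) by (simp add: increasing_flip_def)
      then obtain H where "H \<in> \<I>" "A H \<noteq> C H"
        using less.prems(1) CP unfolding carrier_P by (meson extensionalityI)
      then have "(\<Sum>H\<in>\<I>. B H - C H) < (\<Sum>H\<in>\<I>. B H - A H)"
      proof (intro sum_strict_mono_ex1 finite_hyperedges ballI bexI)
        show "B H - C H < B H - A H"
          using C(3) \<open>H \<in> \<I>\<close> \<open>A H \<noteq> C H\<close> by (metis diff_less_mono2 le_neq_implies_less less_le_trans)
      qed (use C(3) \<open>H \<in> \<I>\<close> in \<open>auto intro: diff_le_mono2\<close>)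
      then have "(C, B) \<in> R\<^sup>*" using less.hyps CP C(3) by blast
      moreover have "(A, C) \<in> R"
        using C less.prems(1) unfolding R_def by (simp add: hypergraphic_poset_def)
      ultimately show ?thesis by (rule converse_rtrancl_into_rtrancl[rotated])
    qed simp
  qed
  ultimately have "(A, B) \<in> R\<^sup>* \<longleftrightarrow> (\<forall>H\<in>\<I>. A H \<le> B H)" by (rule iffI)
  then show ?thesis unfolding hypergraphic_poset_def R_def by simp
qed

lemma eq_P: "A .=\<^bsub>P\<^esub> B \<longleftrightarrow> A = B"
  by (simp add: hypergraphic_poset_def)

section \<open>Necessity of the condition\<close>

text \<open>Orientations choosing the first element of each hyperedge in a fixed order of \<open>[n]\<close> are acyclic;
  \<open>front x\<close> moves \<open>x\<close> to the beginning of that order.\<close>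

definition front :: "nat \<Rightarrow> (nat set \<Rightarrow> nat) \<Rightarrow> nat set \<Rightarrow> nat" where
  "front x A H = (if x \<in> H then x else A H)"

lemma compat_front: "compat A \<Longrightarrow> compat (front x A)"
  by (auto simp: compat_def front_def)

lemma Min_hyperedge_mem: "H \<in> \<I> \<Longrightarrow> Min H \<in> H"
  by (simp add: hyperedge_finite hyperedge_nonempty)

lemma Max_hyperedge_mem: "H \<in> \<I> \<Longrightarrow> Max H \<in> H"
  by (simp add: hyperedge_finite hyperedge_nonempty)

lemma Min_hyperedge_le: "H \<in> \<I> \<Longrightarrow> x \<in> H \<Longrightarrow> Min H \<le> x"
  by (simp add: hyperedge_finite)

lemma Max_hyperedge_ge: "H \<in> \<I> \<Longrightarrow> x \<in> H \<Longrightarrow> x \<le> Max H"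
  by (simp add: hyperedge_finite)

lemma compat_Min: "compat Min"
  unfolding compat_def by (meson antisym Min_hyperedge_mem Min_hyperedge_le)

lemma compat_Max: "compat Max"
  unfolding compat_def by (meson antisym Max_hyperedge_mem Max_hyperedge_ge)

text \<open>This moves the elements below \<open>c\<close>, in increasing order, to the front. If
  \<open>Min H < c\<close> lies in \<open>K\<close>, then \<open>Min K < c\<close> as well, so the
  two cases never mix.\<close>

lemma compat_low_first:
  assumes A: "compat A"
  shows "compat (\<lambda>H. if Min H < c then Min H else A H)"
  unfolding compat_def
proof (intro conjI ballI impI)
  fix H K assume HK: "H \<in> \<I>" "K \<in> \<I>"
    "(if Min H < c then Min H else A H) \<in> K" "(if Min K < c then Min K else A K) \<in> H"
  then show "(if Min H < c then Min H else A H) = (if Min K < c then Min K else A K)"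
    using Min_hyperedge_le[OF HK(1) HK(4)] Min_hyperedge_le[OF HK(2) HK(3)] compat_eq[OF A HK(1,2)]
    by (auto split: if_splits)
qed (use compat_mem[OF A] Min_hyperedge_mem in auto)

lemma compat_high_first:
  assumes A: "compat A"
  shows "compat (\<lambda>H. if b < Max H then Max H else A H)"
  unfolding compat_def
proof (intro conjI ballI impI)
  fix H K assume HK: "H \<in> \<I>" "K \<in> \<I>"
    "(if b < Max H then Max H else A H) \<in> K" "(if b < Max K then Max K else A K) \<in> H"
  then show "(if b < Max H then Max H else A H) = (if b < Max K then Max K else A K)"
    using Max_hyperedge_ge[OF HK(1) HK(4)] Max_hyperedge_ge[OF HK(2) HK(3)] compat_eq[OF A HK(1,2)]
    by (auto split: if_splits)
qed (use compat_mem[OF A] Max_hyperedge_mem in auto)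

lemma le_P_restrict_iff:
  assumes "compat A" "compat B"
  shows "restrict A \<I> \<sqsubseteq>\<^bsub>P\<^esub> restrict B \<I> \<longleftrightarrow> (\<forall>H\<in>\<I>. A H \<le> B H)"
  using assms by (subst le_P_iff) (auto simp: hypergraphic_poset_def restrict_acyclic)

lemma restrict_carrier: "compat A \<Longrightarrow> restrict A \<I> \<in> carrier P"
  by (simp add: hypergraphic_poset_def restrict_acyclic)

lemma lattice_inter_closed:
  assumes "lattice P" and I: "{a..b} \<in> \<I>" and J: "{c..d} \<in> \<I>" and "a < c" "c \<le> b" "b < d"
  shows "{c..b} \<in> \<I>"
proof (rule ccontr)
  assume notin: "{c..b} \<notin> \<I>"
  interpret lattice P by fact
  \<comment> \<open>The underlying orders: \<open>A1\<close> takes the elements below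
    \<open>c\<close> ascending, then \<open>b\<close>, then ascends; \<open>A2\<close> takes
    \<open>c\<close>, then ascends; \<open>B1\<close> takes the elements above \<open>b\<close>
    descending, then \<open>c\<close>, then descends; \<open>B2\<close> takes \<open>b\<close>, then
    descends.\<close>
  define A1 where "A1 H = (if Min H < c then Min H else front b Min H)" for H
  define A2 where "A2 = front c Min"
  define B1 where "B1 H = (if b < Max H then Max H else front c Max H)" for H
  define B2 where "B2 = front b Max"
  have comp: "compat A1" "compat A2" "compat B1" "compat B2"
    unfolding A1_def A2_def B1_def B2_def
    by (intro compat_low_first compat_high_first compat_front compat_Min compat_Max)+
  have "{c} \<in> \<I>" using singleton_hyperedge[OF I] assms by simp
  then have "c \<noteq> b" using notin by auto
  have le: "A1 H \<le> B1 H \<and> A1 H \<le> B2 H \<and> A2 H \<le> B1 H \<and> A2 H \<le> B2 H" if H: "H \<in> \<I>" for H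
  proof -
    obtain u v where uv: "H = {u..v}" "u \<le> v" using hyperedgeE[OF H] by metis
    \<comment> \<open>A comparison can fail only at \<open>[c,b]\<close>, where \<open>A1\<close> is
      \<open>b\<close> and \<open>B1\<close> is \<open>c\<close>.\<close>
    then have "u \<noteq> c \<or> v \<noteq> b" using H notin by auto
    moreover have "Min H = u" "Max H = v" using uv by simp_all
    ultimately show ?thesis
      using uv \<open>c \<le> b\<close> unfolding A1_def A2_def B1_def B2_def front_def by auto
  qed
  define M where "M = restrict A1 \<I> \<squnion>\<^bsub>P\<^esub> restrict A2 \<I>"
  have M: "M \<in> carrier P" unfolding M_def using comp by (intro join_closed restrict_carrier)
  then have M': "compat M" by (simp add: carrier_P)
  have "restrict A1 \<I> \<sqsubseteq>\<^bsub>P\<^esub> M" "restrict A2 \<I> \<sqsubseteq>\<^bsub>P\<^esub> M"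
    unfolding M_def using comp by (auto intro!: join_left join_right restrict_carrier)
  moreover have "M \<sqsubseteq>\<^bsub>P\<^esub> restrict B1 \<I>" "M \<sqsubseteq>\<^bsub>P\<^esub> restrict B2 \<I>"
    unfolding M_def using comp le by (auto intro!: join_le restrict_carrier simp: le_P_restrict_iff)
  ultimately have bounds: "A1 H \<le> M H" "A2 H \<le> M H" "M H \<le> B1 H" "M H \<le> B2 H" if "H \<in> \<I>" for H
    using that M comp by (simp_all add: le_P_iff restrict_carrier)
  \<comment> \<open>\<open>A2\<close> and \<open>B1\<close> agree at \<open>[a,b]\<close>, and
    \<open>A1\<close> and \<open>B2\<close> agree at \<open>[c,d]\<close>, which pins down
    \<open>M\<close> there.\<close>
  have "M {a..b} = c"
    using bounds(2,3)[OF I] assms(4-) unfolding A2_def B1_def front_def by simp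
  moreover have "M {c..d} = b"
    using bounds(1,4)[OF J] assms(4-) unfolding A1_def B2_def front_def by simp
  ultimately show False
    using compat_eq[OF M' I J] assms(4-) \<open>c \<noteq> b\<close> by simp
qed

text \<open>\<open>X\<close> and \<open>Z\<close> differ only in whether \<open>a\<close> or
  \<open>d\<close> comes first, hence only on hyperedges containing both; \<open>Y\<close> puts
  \<open>c\<close> first. Together they violate cancellation, as \<open>[p,q]\<close> separates
  \<open>X\<close> from \<open>Z\<close>.\<close>

lemma distributive_no_crossing_below:
  assumes dist: "distributive_lattice P"
    and I: "{a..b} \<in> \<I>" and J: "{c..d} \<in> \<I>" and K: "{p..q} \<in> \<I>"
    and ab: "a < c" "c \<le> b" "b < d" and pq: "p \<le> a" "d \<le> q"
  shows False
proof -
  define X where "X = front a (front d Min)"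
  define Y where "Y = front c Min"
  define Z where "Z = front d (front a Min)"
  have comp: "compat X" "compat Y" "compat Z"
    unfolding X_def Y_def Z_def by (intro compat_front compat_Min)+
  have same: "X H = Z H" if "\<not> {a, d} \<subseteq> H" for H
    using that unfolding X_def Z_def front_def by auto
  have sub: "{a..b} \<subseteq> H" "{c..d} \<subseteq> H" if "H \<in> \<I>" "{a, d} \<subseteq> H" for H
    using that ab by (auto intro: hyperedge_convex[of H a d])
  have big: "X H = a" "Z H = d" "Y H = c" if "H \<in> \<I>" "{a, d} \<subseteq> H" for H
  proof -
    have "c \<in> H" using sub(2)[OF that] ab by auto
    then show "X H = a" "Z H = d" "Y H = c"
      using that ab unfolding X_def Y_def Z_def front_def by auto
  qed
  have IJ: "X {c..d} = d" "Z {a..b} = a" "Y {a..b} = c" "Y {c..d} = c"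
    using ab unfolding X_def Y_def Z_def front_def by auto
  have "restrict Z \<I> \<sqsubseteq>\<^bsub>P\<^esub> restrict X \<I>"
  proof (rule distributive_lattice_modular_cancel[OF dist, of _ "restrict Y \<I>"])
    fix U assume U: "U \<in> carrier P" "restrict X \<I> \<sqsubseteq>\<^bsub>P\<^esub> U" "restrict Y \<I> \<sqsubseteq>\<^bsub>P\<^esub> U"
    then have C: "compat U" by (simp add: carrier_P)
    have XY: "X H \<le> U H" "Y H \<le> U H" if "H \<in> \<I>" for H
      using U that comp by (simp_all add: le_P_iff restrict_carrier)
    have "Z H \<le> U H" if H: "H \<in> \<I>" for H
    proof (cases "{a, d} \<subseteq> H")
      case True
      note s = sub[OF H True]
      have HI: "U H = U {a..b}" if "U H \<in> {a..b}"
        using compat_eq[OF C H I that] compat_mem[OF C I] s by blast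
      have HJ: "U H = U {c..d}" if "U H \<in> {c..d}"
        using compat_eq[OF C H J that] compat_mem[OF C J] s by blast
      have "d \<le> U {c..d}" "c \<le> U H"
        using XY(1)[OF J] XY(2)[OF H] IJ big[OF H True] by simp_all
      \<comment> \<open>If \<open>U H \<le> d\<close>, it lies in \<open>[c,d]\<close>, so it equals
        \<open>U {c..d}\<close>, which is at least \<open>d\<close>.\<close>
      then show ?thesis using HJ big[OF H True] by (cases "U H \<le> d") auto
    next
      case False
      then show ?thesis using XY(1)[OF H] same by simp
    qed
    then show "restrict Z \<I> \<sqsubseteq>\<^bsub>P\<^esub> U" using U(1) comp by (simp add: le_P_iff restrict_carrier)
  next
    fix V assume V: "V \<in> carrier P" "V \<sqsubseteq>\<^bsub>P\<^esub> restrict Z \<I>" "V \<sqsubseteq>\<^bsub>P\<^esub> restrict Y \<I>"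
    then have C: "compat V" by (simp add: carrier_P)
    have ZY: "V H \<le> Z H" "V H \<le> Y H" if "H \<in> \<I>" for H
      using V that comp by (simp_all add: le_P_iff restrict_carrier)
    have "V H \<le> X H" if H: "H \<in> \<I>" for H
    proof (cases "{a, d} \<subseteq> H")
      case True
      note s = sub[OF H True]
      have HI: "V H = V {a..b}" if "V H \<in> {a..b}"
        using compat_eq[OF C H I that] compat_mem[OF C I] s by blast
      have "V {a..b} \<le> a" "V H \<le> c"
        using ZY(1)[OF I] ZY(2)[OF H] IJ big[OF H True] by simp_all
      \<comment> \<open>Dually, if \<open>a \<le> V H\<close>, it lies in \<open>[a,b]\<close>, so
        it equals \<open>V {a..b}\<close>, which is at most \<open>a\<close>.\<close>
      then show ?thesis using HI big[OF H True] ab by (cases "a \<le> V H") auto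
    next
      case False
      then show ?thesis using ZY(1)[OF H] same by simp
    qed
    then show "V \<sqsubseteq>\<^bsub>P\<^esub> restrict X \<I>" using V(1) comp by (simp add: le_P_iff restrict_carrier)
  qed (use comp restrict_carrier in auto)
  then have "Z {p..q} \<le> X {p..q}" using K comp by (simp add: le_P_restrict_iff)
  then show False using big[OF K] ab pq by simp
qed

lemma distributive_imp_condition:
  assumes dist: "distributive_lattice P"
    and I: "{a..b} \<in> \<I>" and J: "{c..d} \<in> \<I>" and ab: "a < c" "c \<le> b" "b < d"
  shows "{c..b} \<in> \<I>" and "{p..q} \<in> \<I> \<Longrightarrow> p < c \<Longrightarrow> b < q \<Longrightarrow> False"
proof -
  have lat: "lattice P" using dist by (simp add: distributive_lattice_def)
  show "{c..b} \<in> \<I>" by (rule lattice_inter_closed[OF lat I J ab])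
  assume K: "{p..q} \<in> \<I>" and pq: "p < c" "b < q"
  \<comment> \<open>If \<open>I\<close> sticks out of \<open>K\<close> on the left, the two cross
    and their intersection replaces \<open>I\<close>; \<open>J\<close> is trimmed likewise on the
    right. The results still cross.\<close>
  have I': "{max a p..b} \<in> \<I>"
  proof (cases "a < p")
    case True
    then show ?thesis using lattice_inter_closed[OF lat I K] pq ab by simp
  qed (use I in \<open>simp add: max_def\<close>)
  have J': "{c..min d q} \<in> \<I>"
  proof (cases "q < d")
    case True
    then show ?thesis using lattice_inter_closed[OF lat K J] pq ab by simp
  qed (use J in \<open>simp add: min_def\<close>)
  show False
    by (rule distributive_no_crossing_below[OF dist I' J' K]) (use ab pq in auto)
qed

end

section \<open>Sufficiency: blocks as coordinates\<close>

locale laminar_hg = interval_hg +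
  assumes inter_closed: "H \<in> \<I> \<Longrightarrow> K \<in> \<I> \<Longrightarrow> H \<inter> K \<noteq> {} \<Longrightarrow> H \<inter> K \<in> \<I>"
    and laminar: "H \<in> \<I> \<Longrightarrow> H' \<in> \<I> \<Longrightarrow> K \<in> \<I> \<Longrightarrow> H \<subseteq> K \<Longrightarrow> H' \<subseteq> K \<Longrightarrow> H \<inter> H' \<noteq> {} \<Longrightarrow>
      H \<subseteq> H' \<or> H' \<subseteq> H"
begin

text \<open>For \<open>x\<close> in a member \<open>K\<close>, this is the maximal proper
  subinterval around \<open>x\<close>; inserting \<open>x\<close> makes a singleton its own
  block.\<close>

definition block :: "nat set \<Rightarrow> nat \<Rightarrow> nat set" where
  "block K x = insert x (\<Union>{H \<in> \<I>. x \<in> H \<and> H \<subset> K})"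

lemma mem_block [simp]: "x \<in> block K x"
  by (simp add: block_def)

lemma block_upper: "H \<in> \<I> \<Longrightarrow> x \<in> H \<Longrightarrow> H \<subset> K \<Longrightarrow> H \<subseteq> block K x"
  by (auto simp: block_def)

text \<open>By laminarity a maximal proper member around \<open>x\<close> absorbs all others, so the
  union is that member. There is none only if \<open>K = {x}\<close>.\<close>

lemma block_hyperedge:
  assumes "K \<in> \<I>" "x \<in> K"
  shows "block K x \<in> \<I> \<and> (block K x \<subset> K \<or> K = {x} \<and> block K x = {x})"
proof -
  define F where "F = {H \<in> \<I>. x \<in> H \<and> H \<subset> K}"
  show ?thesis
  proof (cases "F = {}")
    case True
    then have "block K x = {x}" by (simp add: block_def F_def[symmetric])
    then show ?thesis using singleton_hyperedge[OF assms] assms by auto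
  next
    case False
    have "finite F" unfolding F_def using finite_hyperedges by simp
    then obtain H0 where H0: "H0 \<in> F" "\<And>H. H \<in> F \<Longrightarrow> H0 \<subseteq> H \<Longrightarrow> H0 = H"
      using finite_has_maximal[of F] False by metis
    have "H \<subseteq> H0" if "H \<in> F" for H
      using laminar[of H H0 K] H0 that assms(1) unfolding F_def by blast
    then have "block K x = H0" using H0(1) unfolding block_def F_def by blast
    then show ?thesis using H0(1) unfolding F_def by simp
  qed
qed

lemma block_mem: "K \<in> \<I> \<Longrightarrow> x \<in> K \<Longrightarrow> block K x \<in> \<I>"
  and block_subset: "K \<in> \<I> \<Longrightarrow> x \<in> K \<Longrightarrow> block K x \<subseteq> K"
  using block_hyperedge by blast+

text \<open>The block of \<open>x\<close> is a proper member around \<open>y\<close>, hence inside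
  the block of \<open>y\<close>; this puts \<open>x\<close> in the block of \<open>y\<close>, and
  the argument reverses. So blocks partition \<open>K\<close>.\<close>

lemma block_eq:
  assumes K: "K \<in> \<I>" "x \<in> K" and y: "y \<in> block K x"
  shows "block K y = block K x"
proof (cases "y = x")
  case False
  have yK: "y \<in> K" using block_subset[OF K] y by auto
  have ps: "block K x \<subset> K" "block K y \<subset> K"
    using block_hyperedge[OF K] block_hyperedge[OF K(1) yK] False K yK by auto
  have "block K x \<subseteq> block K y" using block_upper[OF block_mem[OF K] y ps(1)] .
  moreover from this have "block K y \<subseteq> block K x"
    using block_upper[OF block_mem[OF K(1) yK] _ ps(2)] mem_block by blast
  ultimately show ?thesis by auto
qed simp

lemma Min_block_mem: "K \<in> \<I> \<Longrightarrow> x \<in> K \<Longrightarrow> Min (block K x) \<in> block K x"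
  using block_mem hyperedge_finite hyperedge_nonempty Min_in by metis

lemma block_eq_iff:
  assumes "K \<in> \<I>" "x \<in> K" "y \<in> K"
  shows "block K x = block K y \<longleftrightarrow> Min (block K x) = Min (block K y)"
  using assms Min_block_mem block_eq by metis

text \<open>Blocks are disjoint or equal intervals, so they are ordered from left to right.\<close>

lemma Min_block_mono:
  assumes K: "K \<in> \<I>" "x \<in> K" "y \<in> K" and "x \<le> y"
  shows "Min (block K x) \<le> Min (block K y)"
proof (rule ccontr)
  assume less: "\<not> Min (block K x) \<le> Min (block K y)"
  have "Min (block K x) \<le> x"
    by (rule Min_le) (use K block_mem hyperedge_finite in auto)
  then have "x \<in> block K y"
    using less \<open>x \<le> y\<close>
    by (intro hyperedge_convex[OF block_mem[OF K(1,3)] Min_block_mem[OF K(1,3)] mem_block]) auto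
  then have "block K x = block K y" by (rule block_eq[OF K(1,3)])
  then show False using less by simp
qed

text \<open>The least element names the block, which turns the blocks of \<open>K\<close> into a
  chain of numbers.\<close>

definition coord :: "(nat set \<Rightarrow> nat) \<Rightarrow> nat set \<Rightarrow> nat" where
  "coord A K = Min (block K (A K))"

text \<open>Different blocks decide the comparison at \<open>K\<close>. If both values lie in one
  proper block \<open>H\<close>, then, without 2-cycles, they are the values at \<open>H\<close>,
  and induction on the size applies.\<close>

lemma le_iff_coord_le:
  assumes A: "compat A" and B: "compat B"
  shows "(\<forall>K\<in>\<I>. A K \<le> B K) \<longleftrightarrow> (\<forall>K\<in>\<I>. coord A K \<le> coord B K)"
proof (intro iffI ballI)
  fix K assume "K \<in> \<I>" "\<forall>K\<in>\<I>. A K \<le> B K"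
  then show "coord A K \<le> coord B K"
    unfolding coord_def by (intro Min_block_mono compat_mem[OF A] compat_mem[OF B]) auto
next
  fix K assume le: "\<forall>K\<in>\<I>. coord A K \<le> coord B K" and "K \<in> \<I>"
  from \<open>K \<in> \<I>\<close> show "A K \<le> B K"
  proof (induction "card K" arbitrary: K rule: less_induct)
    case less
    note K = less.prems
    have AK: "A K \<in> K" and BK: "B K \<in> K" using A B K by (auto intro: compat_mem)
    show ?case
    proof (cases "coord A K < coord B K")
      case True
      then show ?thesis using Min_block_mono[OF K BK AK] unfolding coord_def by (meson leD le_cases)
    next
      case False
      then have eq: "block K (A K) = block K (B K)"
        using le K block_eq_iff[OF K AK BK] unfolding coord_def by (auto intro: antisym)
      define H where "H = block K (A K)"
      have H: "H \<in> \<I>" "H \<subseteq> K" "A K \<in> H" "B K \<in> H"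
        using block_mem[OF K AK] block_subset[OF K AK] eq mem_block unfolding H_def by metis+
      show ?thesis
      proof (cases "H = K")
        case True
        then have "K = {A K}" using block_hyperedge[OF K AK] unfolding H_def by auto
        then have "B K = A K" using BK by blast
        then show ?thesis by simp
      next
        case False
        then have "A H \<le> B H"
          using less.hyps[of H] H(1,2) K hyperedge_finite by (meson psubsetI psubset_card_mono)
        moreover have "A K = A H" using compat_eq[OF A K H(1,3)] compat_mem[OF A H(1)] H(2) by blast
        moreover have "B K = B H" using compat_eq[OF B K H(1,4)] compat_mem[OF B H(1)] H(2) by blast
        ultimately show ?thesis by simp
      qed
    qed
  qed
qed

text \<open>The values are found by descending: \<open>s\<close> sends an interval to its prescribed block, and
  iterating it \<open>n\<close> times ends in a singleton.\<close>

lemma blocks_realizable: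
  assumes t: "\<And>K. K \<in> \<I> \<Longrightarrow> t K \<in> K"
  shows "\<exists>M\<in>carrier P. \<forall>K\<in>\<I>. block K (M K) = block K (t K)"
proof -
  define s where "s K = block K (t K)" for K
  have s: "s K \<in> \<I>" "s K \<subseteq> K" if "K \<in> \<I>" for K
    using block_mem block_subset t that unfolding s_def by auto
  have s_less: "s K \<subset> K" if "K \<in> \<I>" "\<nexists>x. K = {x}" for K
    using block_hyperedge[OF that(1) t[OF that(1)]] that(2) unfolding s_def by metis
  \<comment> \<open>Each step loses an element until a singleton is reached; as
    \<open>card K \<le> n\<close>, this happens within \<open>n\<close> steps.\<close>
  have iter: "(s ^^ m) K \<in> \<I> \<and> (s ^^ m) K \<subseteq> K \<and> ((\<exists>x. (s ^^ m) K = {x}) \<or> card ((s ^^ m) K) + m \<le> card K)"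
    if K: "K \<in> \<I>" for K m
  proof (induction m)
    case (Suc m)
    let ?L = "(s ^^ m) K"
    have L: "?L \<in> \<I>" "?L \<subseteq> K" using Suc by auto
    show ?case
    proof (cases "\<exists>x. ?L = {x}")
      case True
      then obtain x where "?L = {x}" ..
      then have "s ?L = {x}" using s[OF L(1)] hyperedge_nonempty[OF s(1)[OF L(1)]] by auto
      then show ?thesis using s[OF L(1)] L by auto
    next
      case False
      then have "card (s ?L) < card ?L"
        using s_less[OF L(1)] hyperedge_finite[OF L(1)] by (intro psubset_card_mono) auto
      then show ?thesis using s[OF L(1)] L Suc False by auto
    qed
  qed (use K in auto)
  have fin: "\<exists>x. (s ^^ n) K = {x}" if K: "K \<in> \<I>" for K
  proof -
    have "card K \<le> card {1..n}" using hyperedge_range[OF K] by (intro card_mono) auto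
    moreover have "card ((s ^^ n) K) > 0"
      using iter[OF K, of n] hyperedge_finite hyperedge_nonempty by (simp add: card_gt_0_iff)
    ultimately show ?thesis using iter[OF K, of n] by auto
  qed
  define M where "M K = the_elem ((s ^^ n) K)" for K
  have M_mem: "M K \<in> K" if K: "K \<in> \<I>" for K
    using fin[OF K] iter[OF K, of n] unfolding M_def by auto
  have M_s: "M (s K) = M K" if K: "K \<in> \<I>" for K
  proof -
    obtain x where x: "(s ^^ n) K = {x}" using fin[OF K] ..
    have "(s ^^ n) (s K) = s ((s ^^ n) K)" by (metis funpow_swap1)
    \<comment> \<open>The singleton reached is fixed by \<open>s\<close>, so starting one step later
      ends there too.\<close>
    moreover have "s {x} = {x}" using s[of "{x}"] iter[OF K, of n] x hyperedge_nonempty[of "s {x}"] by auto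
    ultimately show ?thesis unfolding M_def x by simp
  qed
  have block_M: "block K (M K) = s K" if K: "K \<in> \<I>" for K
    using block_eq[OF K t[OF K], of "M K"] M_mem[OF s(1)[OF K]] M_s[OF K] unfolding s_def by simp
  have nested: "M K = M H" if "K \<in> \<I>" "H \<in> \<I>" "H \<subseteq> K" "M K \<in> H" for H K
    using that
  proof (induction "card K" arbitrary: K rule: less_induct)
    case (less K)
    show ?case
    proof (cases "H = K")
      case False
      then have "H \<subset> K" using less.prems(3) by auto
      \<comment> \<open>A proper member containing \<open>M K\<close> lies in the block of
        \<open>M K\<close>, so the descent from \<open>K\<close> can be followed until it reaches
        \<open>H\<close>.\<close>
      then have "H \<subseteq> s K" using block_upper[of H "M K" K] less.prems block_M by simp
      moreover have "s K \<subset> K"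
        using s_less[OF less.prems(1)] \<open>H \<subset> K\<close> hyperedge_nonempty[OF less.prems(2)] by blast
      ultimately have "M (s K) = M H"
        using less.prems s(1) M_s hyperedge_finite[OF less.prems(1)]
        by (intro less.hyps) (auto intro: psubset_card_mono)
      then show ?thesis using M_s[OF less.prems(1)] by simp
    qed simp
  qed
  have "compat M"
    unfolding compat_def
  proof (intro conjI ballI impI M_mem)
    fix H K assume HK: "H \<in> \<I>" "K \<in> \<I>" "M H \<in> K" "M K \<in> H"
    then have m: "M H \<in> H \<inter> K" "M K \<in> H \<inter> K" using M_mem by auto
    \<comment> \<open>Both values lie in the intersection, so both equal its value.\<close>
    then have "H \<inter> K \<in> \<I>" using inter_closed HK by blast
    then show "M H = M K" using nested[of H "H \<inter> K"] nested[of K "H \<inter> K"] HK m by simp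
  qed
  then show ?thesis
    using block_M by (intro bexI[of _ "restrict M \<I>"] restrict_carrier) (auto simp: s_def)
qed

text \<open>Prescribing the block of the larger or smaller value realizes the maximum or minimum of
  the coordinates, because \<open>Min_block_mono\<close> makes coordinates monotone.\<close>

theorem distributive: "distributive_lattice P"
proof (rule distributive_latticeI_coordinates[where f = coord and S = \<I>])
  show le: "A \<sqsubseteq>\<^bsub>P\<^esub> B \<longleftrightarrow> (\<forall>K\<in>\<I>. coord A K \<le> coord B K)" if "A \<in> carrier P" "B \<in> carrier P" for A B
    using le_P_iff[OF that] le_iff_coord_le[of A B] that by (simp add: carrier_P)
  show "A = B" if "A \<in> carrier P" "B \<in> carrier P" "\<forall>K\<in>\<I>. coord A K = coord B K" for A B
  proof -
    have "\<forall>K\<in>\<I>. A K \<le> B K" "\<forall>K\<in>\<I>. B K \<le> A K"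
      using that le_iff_coord_le[of A B] le_iff_coord_le[of B A] by (auto simp: carrier_P)
    then show ?thesis using that by (intro extensionalityI[of A \<I>]) (auto simp: carrier_P intro: antisym)
  qed
  fix A B assume AB: "A \<in> carrier P" "B \<in> carrier P"
  then have mem: "A K \<in> K" "B K \<in> K" if "K \<in> \<I>" for K
    using that by (auto simp: carrier_P compat_mem)
  obtain M where "M \<in> carrier P" "\<forall>K\<in>\<I>. block K (M K) = block K (max (A K) (B K))"
    using blocks_realizable[of "\<lambda>K. max (A K) (B K)"] mem unfolding max_def by metis
  then show "\<exists>M\<in>carrier P. \<forall>K\<in>\<I>. coord M K = max (coord A K) (coord B K)"
    using mem Min_block_mono by (intro bexI[of _ M]) (auto simp: coord_def max_def intro: antisym)
  obtain M where "M \<in> carrier P" "\<forall>K\<in>\<I>. block K (M K) = block K (min (A K) (B K))"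
    using blocks_realizable[of "\<lambda>K. min (A K) (B K)"] mem unfolding min_def by metis
  then show "\<exists>M\<in>carrier P. \<forall>K\<in>\<I>. coord M K = min (coord A K) (coord B K)"
    using mem Min_block_mono by (intro bexI[of _ M]) (auto simp: coord_def min_def intro: antisym)
qed (rule eq_P)

end

section \<open>The equivalence for crossing members\<close>

theorem theoremB:
  fixes n :: nat and \<I> :: "nat set set"
  assumes "n \<ge> 1" and "interval_hypergraph n \<I>"
  shows "distributive_lattice (hypergraphic_poset n \<I>) \<longleftrightarrow>
    (\<forall>I\<in>\<I>. \<forall>J\<in>\<I>. \<not> I \<subseteq> J \<and> \<not> J \<subseteq> I \<and> I \<inter> J \<noteq> {} \<longrightarrow>
       I \<inter> J \<in> \<I> \<and>
       (\<forall>K\<in>\<I>. I \<inter> J \<subseteq> K \<longrightarrow> Min (I \<inter> J) = Min K \<or> Max (I \<inter> J) = Max K))"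
    (is "?dist \<longleftrightarrow> (\<forall>I\<in>\<I>. \<forall>J\<in>\<I>. ?cross I J \<longrightarrow> ?cond I J)")
proof -
  interpret interval_hg n \<I> by unfold_locales fact
  show ?thesis
  proof (intro iffI ballI impI)
    assume dist: ?dist
    have cond: "?cond {a..b} {c..d}"
      if ab: "{a..b} \<in> \<I>" "{c..d} \<in> \<I>" "a < c" "c \<le> b" "b < d" for a b c d
    proof -
      have eq: "{a..b} \<inter> {c..d} = {c..b}" using ab by auto
      have "c = Min K \<or> b = Max K" if K: "K \<in> \<I>" "{c..b} \<subseteq> K" for K
      proof -
        obtain p q where pq: "K = {p..q}" "p \<le> q" using hyperedgeE[OF K(1)] by metis
        then have "p \<le> c" "b \<le> q" using K(2) \<open>c \<le> b\<close> by auto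
        moreover have "Min K = p" "Max K = q" using pq by simp_all
        ultimately show ?thesis
          using distributive_imp_condition(2)[OF dist ab, of p q] K(1) pq by (metis le_neq_implies_less)
      qed
      then show ?thesis
        using distributive_imp_condition(1)[OF dist ab] \<open>c \<le> b\<close> unfolding eq by simp
    qed
    fix I J assume IJ: "I \<in> \<I>" "J \<in> \<I>" "?cross I J"
    obtain a b where ab: "I = {a..b}" "a \<le> b" using hyperedgeE[OF IJ(1)] by metis
    obtain c d where cd: "J = {c..d}" "c \<le> d" using hyperedgeE[OF IJ(2)] by metis
    have "a < c \<and> c \<le> b \<and> b < d \<or> c < a \<and> a \<le> d \<and> d < b" using IJ(3) ab cd by auto
    then show "?cond I J"
    proof
      assume "a < c \<and> c \<le> b \<and> b < d"
      then show ?thesis using cond[of a b c d] IJ(1,2) ab(1) cd(1) by blast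
    next
      assume "c < a \<and> a \<le> d \<and> d < b"
      then have "?cond J I" using cond[of c d a b] IJ(1,2) ab(1) cd(1) by blast
      then show ?thesis unfolding Int_commute[of J I] .
    qed
  next
    assume cond: "\<forall>I\<in>\<I>. \<forall>J\<in>\<I>. ?cross I J \<longrightarrow> ?cond I J"
    interpret laminar_hg n \<I>
    proof
      show "H \<inter> K \<in> \<I>" if "H \<in> \<I>" "K \<in> \<I>" "H \<inter> K \<noteq> {}" for H K
      proof (cases "H \<subseteq> K \<or> K \<subseteq> H")
        case True
        then show ?thesis using that by (auto simp: inf.absorb1 inf.absorb2)
      next
        case False
        then show ?thesis using cond[rule_format, OF that(1,2)] that(3) by simp
      qed
      show "H \<subseteq> H' \<or> H' \<subseteq> H"
        if H: "H \<in> \<I>" "H' \<in> \<I>" "K \<in> \<I>" "H \<subseteq> K" "H' \<subseteq> K" "H \<inter> H' \<noteq> {}" for H H' K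
      proof (rule ccontr)
        assume neg: "\<not> (H \<subseteq> H' \<or> H' \<subseteq> H)"
        have "H \<inter> H' \<subseteq> K" using H(4) by blast
        then have ends: "Min (H \<inter> H') = Min K \<or> Max (H \<inter> H') = Max K"
          using cond[rule_format, OF H(1,2)] neg H(3,6) by simp
        obtain a b where ab: "H = {a..b}" "a \<le> b" using hyperedgeE[OF H(1)] by metis
        obtain c d where cd: "H' = {c..d}" "c \<le> d" using hyperedgeE[OF H(2)] by metis
        obtain p q where pq: "K = {p..q}" "p \<le> q" using hyperedgeE[OF H(3)] by metis
        note i = ab cd pq
        have "p \<le> a \<and> b \<le> q \<and> p \<le> c \<and> d \<le> q" using H(4,5) i by auto
        moreover have "{a..b} \<inter> {c..d} = {max a c..min b d}" by auto
        moreover have "max a c \<le> min b d" "a < c \<and> b < d \<or> c < a \<and> d < b"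
          using H(6) neg i by auto
        \<comment> \<open>The intersection starts at the larger left end and stops at the smaller
          right end, so both its ends are strictly inside \<open>K\<close>.\<close>
        ultimately show False using ends i by auto
      qed
    qed
    show ?dist by (rule distributive)
  qed
qed

end
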